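(* Let $f:\mathcal{S}^{2\times 2}\to\mathbb{R}$. Then $f$ is symmetric polyaffine if and only if $f$ is affine.
   Context: $\mathcal{S}^{2\times 2}$ denotes the space of symmetric matrices in $\mathbb{R}^{2\times 2}$, and $F^s=\frac12(F+F^T)$. A function $\tilde f:\mathbb{R}^{2\times 2}\to\mathbb{R}$ is polyconvex if there is a convex function $G:\mathbb{R}^{2\times 2}\times\mathbb{R}\to\mathbb{R}$ with $\tilde f(F)=G(F,\det F)$ for all $F\in\mathbb{R}^{2\times 2}$. A function $f:\mathcal{S}^{2\times 2}\to\mathbb{R}$ is symmetric polyconvex if $\tilde f:\mathbb{R}^{2\times 2}\to\mathbb{R}$, $\tilde f(F)=f(F^s)$, is polyconvex; it is symmetric polyaffine if both $f$ and $-f$ are symmetric polyconvex. *)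

theory Defs
  imports "HOL-Analysis.Analysis"
begin

(* A function f on the symmetric matrices is represented by a total function on real^2^2;
   every notion below uses only its values on sym_matrices. *)
definition sym_matrices :: "(real^2^2) set" where
  "sym_matrices = {A. transpose A = A}"

definition sym_part :: "real^2^2 \<Rightarrow> real^2^2" where
  "sym_part F = (1/2) *\<^sub>R (F + transpose F)"

lemma sym_part_in_sym_matrices: "sym_part F \<in> sym_matrices"
  by (simp add: sym_part_def sym_matrices_def transpose_def vec_eq_iff add.commute)

lemma sym_part_eq_self: "A \<in> sym_matrices \<Longrightarrow> sym_part A = A"
  by (simp add: sym_part_def sym_matrices_def vec_eq_iff)

lemma subspace_sym_matrices: "subspace sym_matrices"
  by (simp add: subspace_def sym_matrices_def transpose_def vec_eq_iff)

definition polyconvex :: "(real^2^2 \<Rightarrow> real) \<Rightarrow> bool" where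
  "polyconvex g \<longleftrightarrow>
     (\<exists>G :: (real^2^2) \<times> real \<Rightarrow> real. convex_on UNIV G \<and> (\<forall>F. g F = G (F, det F)))"

definition symmetric_polyconvex :: "(real^2^2 \<Rightarrow> real) \<Rightarrow> bool" where
  "symmetric_polyconvex f \<longleftrightarrow> polyconvex (\<lambda>F. f (sym_part F))"

definition symmetric_polyaffine :: "(real^2^2 \<Rightarrow> real) \<Rightarrow> bool" where
  "symmetric_polyaffine f \<longleftrightarrow> symmetric_polyconvex f \<and> symmetric_polyconvex (\<lambda>A. - f A)"

(* Linearity and affinity of a map defined on a subspace S; the library's "linear" is
   only available on whole types. *)
definition linear_functional_on :: "'a::real_vector set \<Rightarrow> ('a \<Rightarrow> real) \<Rightarrow> bool" where
  "linear_functional_on S L \<longleftrightarrow>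
     (\<forall>x\<in>S. \<forall>y\<in>S. L (x + y) = L x + L y) \<and> (\<forall>r. \<forall>x\<in>S. L (r *\<^sub>R x) = r * L x)"

definition affine_function_on :: "'a::real_vector set \<Rightarrow> ('a \<Rightarrow> real) \<Rightarrow> bool" where
  "affine_function_on S f \<longleftrightarrow>
     (\<exists>L c. linear_functional_on S L \<and> (\<forall>x\<in>S. f x = L x + c))"

end

theory Submission
  imports Defs
begin

text \<open>
  Affine functions are symmetric polyaffine because the symmetric part depends linearly on the
  matrix.  For the converse, the determinant is affine along a line whose direction has rank at
  most one, so along such a line both \<open>\<plusminus> f(F\<^sup>s)\<close> are convex, and hence \<open>f(F\<^sup>s)\<close> is affine
  (\<open>symmetric_polyaffine_singular_line\<close>).  The symmetric parts of singular matrices are exactly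
  the symmetric matrices of nonpositive determinant: adding the skew matrix with entries \<open>\<plusminus>w\<close>
  raises the determinant of a symmetric matrix by \<open>w\<^sup>2\<close>.  Thus \<open>f\<close> is affine along every symmetric
  direction of nonpositive determinant (\<open>symmetric_polyaffine_det_nonpos\<close>).

  A symmetric direction \<open>S\<close> with \<open>det S > 0\<close> splits as \<open>U + V\<close> such that \<open>U\<close>, \<open>V\<close> and \<open>U - V\<close> all
  have nonpositive determinant.  Then \<open>(s, t) \<mapsto> f (X + s U + t V)\<close> is biaffine, and its only
  nonlinear coefficient, that of \<open>s t\<close>, vanishes because the function is also affine along
  \<open>t = - s\<close> (\<open>affine_along_sum\<close>).  So \<open>f\<close> is affine along all symmetric lines, and therefore
  affine.
\<close>

section \<open>Functions that are affine along lines\<close>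

definition affine_along :: "'a::real_vector set \<Rightarrow> ('a \<Rightarrow> real) \<Rightarrow> 'a \<Rightarrow> bool" where
  "affine_along S f D \<longleftrightarrow> (\<forall>X\<in>S. \<forall>s. f (X + s *\<^sub>R D) = f X + s * (f (X + D) - f X))"

lemma affine_alongD:
  assumes "affine_along S f D" "X \<in> S"
  shows "f (X + s *\<^sub>R D) = f X + s * (f (X + D) - f X)"
  using assms by (simp add: affine_along_def)

lemma convex_concave_real_affine:
  fixes h :: "real \<Rightarrow> real"
  assumes "convex_on UNIV h" "convex_on UNIV (\<lambda>x. - h x)"
  shows "h s = h 0 + s * (h 1 - h 0)"
proof -
  have combo: "h ((1 - t) * a + t * b) = (1 - t) * h a + t * h b" if "0 \<le> t" "t \<le> 1" for t a b
    using convex_onD[OF assms(1), of t a b] convex_onD[OF assms(2), of t a b] that by simp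
  \<comment> \<open>In each case the one of \<open>0\<close>, \<open>1\<close>, \<open>s\<close> lying between the other two is their convex combination.\<close>
  consider "0 \<le> s \<and> s \<le> 1" | "s > 1" | "s < 0" by linarith
  then show ?thesis
  proof cases
    case 1
    then show ?thesis using combo[of s 0 1] by (simp add: algebra_simps)
  next
    case 2
    then show ?thesis using combo[of "1/s" 0 s] by (simp add: field_simps)
  next
    case 3
    define t where "t = 1 / (1 - s)"
    have t: "0 \<le> t" "t \<le> 1" "t * (1 - s) = 1" using 3 by (auto simp: t_def)
    have "(1 - t) * 1 + t * s = 0" using t(3) by (simp add: algebra_simps)
    then have "h 0 = (1 - t) * h 1 + t * h s" using combo[OF t(1,2), of 1 s] by simp
    then have "(1 - s) * h 0 = (1 - s) * ((1 - t) * h 1 + t * h s)" by simp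
    also have "\<dots> = ((1 - s) - t * (1 - s)) * h 1 + (t * (1 - s)) * h s"
      by (simp add: algebra_simps)
    finally show ?thesis unfolding t(3) by (simp add: algebra_simps)
  qed
qed

text \<open>
  Without the hypothesis on \<open>U - V\<close> the bilinear form \<open>(s, t) \<mapsto> s t\<close> is a counterexample; on the
  antidiagonal its restriction is \<open>- s\<^sup>2\<close>, which that hypothesis excludes.
\<close>
lemma affine_along_sum:
  assumes "subspace S" "U \<in> S" "V \<in> S"
    and U: "affine_along S f U" and V: "affine_along S f V" and UV: "affine_along S f (U - V)"
  shows "affine_along S f (U + V)"
  unfolding affine_along_def
proof (intro ballI allI)
  fix X s assume X: "X \<in> S"
  define k where "k s t = f (X + s *\<^sub>R U + t *\<^sub>R V)" for s t
  have in_S: "X + s *\<^sub>R U \<in> S" "X + t *\<^sub>R V \<in> S" for s t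
    using assms(1-3) X by (simp_all add: subspace_add subspace_scale)
  have k_left: "k s t = k 0 t + s * (k 1 t - k 0 t)" for s t
    using affine_alongD[OF U in_S(2)[of t], of s] by (simp add: k_def algebra_simps)
  have k_right: "k s t = k s 0 + t * (k s 1 - k s 0)" for s t
    using affine_alongD[OF V in_S(1)[of s], of t] by (simp add: k_def)
  have anti: "k (- 1) 1 = k 0 0 - (k 1 (- 1) - k 0 0)"
    using affine_alongD[OF UV X, of "- 1"] by (simp add: k_def algebra_simps)
  have "k (- 1) 1 = 2 * k 0 1 - k 1 1" using k_left[of "- 1" 1] by simp
  moreover have "k 1 (- 1) = 2 * k 1 0 - k 1 1" using k_right[of 1 "- 1"] by simp
  ultimately have mixed: "k 1 1 = k 1 0 + k 0 1 - k 0 0" using anti by simp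
  have s1: "k s 1 = k 0 1 + s * (k 1 0 - k 0 0)" using k_left[of s 1] mixed by simp
  have "k s s = k s 0 + s * (k s 1 - k s 0)" by (rule k_right)
  also have "k s 1 - k s 0 = k 0 1 - k 0 0" using s1 k_left[of s 0] by simp
  also have "k s 0 = k 0 0 + s * (k 1 0 - k 0 0)" by (rule k_left)
  finally have "k s s = k 0 0 + s * (k 1 1 - k 0 0)" unfolding mixed by (simp add: algebra_simps)
  then show "f (X + s *\<^sub>R (U + V)) = f X + s * (f (X + (U + V)) - f X)"
    by (simp add: k_def algebra_simps)
qed

lemma affine_function_on_if_affine_along:
  assumes S: "subspace S" and f: "\<And>D. D \<in> S \<Longrightarrow> affine_along S f D"
  shows "affine_function_on S f"
proof -
  define L where "L x = f x - f 0" for x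
  have scale: "L (r *\<^sub>R x) = r * L x" if "x \<in> S" for r x
    using affine_alongD[OF f[OF that] subspace_0[OF S], of r] by (simp add: L_def)
  have add: "L (x + y) = L x + L y" if x: "x \<in> S" and y: "y \<in> S" for x y
  proof -
    \<comment> \<open>The midpoint of \<open>x\<close> and \<open>y\<close> lies halfway along the line through \<open>x\<close> in direction \<open>y - x\<close>.\<close>
    have "f (x + (1/2) *\<^sub>R (y - x)) = f x + (1/2) * (f (x + (y - x)) - f x)"
      by (rule affine_alongD[OF f[OF subspace_diff[OF S y x]] x])
    moreover have "x + (1/2) *\<^sub>R (y - x) = (1/2) *\<^sub>R (x + y)"
    proof -
      have "x + (1/2) *\<^sub>R (y - x) = (x - (1/2) *\<^sub>R x) + (1/2) *\<^sub>R y"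
        by (simp add: scaleR_right_diff_distrib)
      also have "x - (1/2) *\<^sub>R x = (1/2) *\<^sub>R x"
        using scaleR_left_diff_distrib[of 1 "1/2" x] by simp
      finally show ?thesis by (simp add: scaleR_add_right)
    qed
    ultimately have mid: "f ((1/2) *\<^sub>R (x + y)) = f x + (1/2) * (f y - f x)" by simp
    have "L ((1/2) *\<^sub>R (x + y)) = (1/2) * (L x + L y)"
      unfolding L_def mid by (simp add: field_simps)
    then show ?thesis using scale[OF subspace_add[OF S x y], of "1/2"] by simp
  qed
  have "linear_functional_on S L" by (simp add: linear_functional_on_def add scale)
  moreover have "\<forall>x\<in>S. f x = L x + f 0" by (simp add: L_def)
  ultimately show ?thesis unfolding affine_function_on_def by blast
qed

section \<open>Rank-one lines and symmetric directions\<close>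

lemma det_add_scaleR_2:
  fixes F R :: "real^2^2"
  shows "det (F + s *\<^sub>R R) = det F + s * (det (F + R) - det F - det R) + s\<^sup>2 * det R"
  by (simp add: det_2 algebra_simps power2_eq_square)

lemma linear_sym_part: "linear sym_part"
  by (rule linearI) (simp_all add: sym_part_def transpose_def vec_eq_iff algebra_simps)

lemma polyconvex_singular_line:
  assumes "polyconvex g" "det R = 0"
  shows "convex_on UNIV (\<lambda>s::real. g (F + s *\<^sub>R R))"
proof -
  obtain G where G: "convex_on UNIV G" and g: "\<And>F. g F = G (F, det F)"
    using assms(1) by (auto simp: polyconvex_def)
  define c where "c = det (F + R) - det F"
  have g_line: "g (F + s *\<^sub>R R) = G (F + s *\<^sub>R R, det F + s * c)" for s
    unfolding g by (simp add: det_add_scaleR_2 assms(2) c_def)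
  show ?thesis
  proof (rule convex_onI)
    fix t x y :: real assume t: "0 < t" "t < 1"
    have line: "(F + ((1 - t) * x + t * y) *\<^sub>R R, det F + ((1 - t) * x + t * y) * c)
        = (1 - t) *\<^sub>R (F + x *\<^sub>R R, det F + x * c) + t *\<^sub>R (F + y *\<^sub>R R, det F + y * c)"
      by (simp add: vec_eq_iff algebra_simps)
    show "g (F + ((1 - t) *\<^sub>R x + t *\<^sub>R y) *\<^sub>R R)
        \<le> (1 - t) * g (F + x *\<^sub>R R) + t * g (F + y *\<^sub>R R)"
      unfolding real_scaleR_def g_line line by (rule convex_onD[OF G]) (use t in simp_all)
  qed simp
qed

lemma symmetric_polyaffine_singular_line:
  assumes f: "symmetric_polyaffine f" and R: "det R = 0"
  shows "affine_along sym_matrices f (sym_part R)"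
  unfolding affine_along_def
proof (intro ballI allI)
  fix X and s :: real assume X: "X \<in> sym_matrices"
  define h where "h s = f (sym_part (X + s *\<^sub>R R))" for s
  have "convex_on UNIV h" "convex_on UNIV (\<lambda>s. - h s)"
    using f polyconvex_singular_line[OF _ R]
    unfolding h_def symmetric_polyaffine_def symmetric_polyconvex_def by blast+
  moreover have "h s = f (X + s *\<^sub>R sym_part R)" for s
    unfolding h_def
    by (simp add: linear_add[OF linear_sym_part] linear_scale[OF linear_sym_part]
        sym_part_eq_self[OF X])
  ultimately show "f (X + s *\<^sub>R sym_part R) = f X + s * (f (X + sym_part R) - f X)"
    using convex_concave_real_affine[of h s] by simp
qed

lemma in_sym_matrices_iff: "A \<in> sym_matrices \<longleftrightarrow> A $ 1 $ 2 = A $ 2 $ 1"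
  by (auto simp: sym_matrices_def transpose_def vec_eq_iff forall_2)

text \<open>
  The free skew part of a matrix with prescribed symmetric part \<open>D\<close> can be used to make it
  singular.
\<close>
lemma ex_singular_sym_part:
  assumes D: "D \<in> sym_matrices" and neg: "det D \<le> 0"
  shows "\<exists>R. det R = 0 \<and> sym_part R = D"
proof -
  define w where "w = sqrt (- det D)"
  define R :: "real^2^2" where "R = D + vector [vector [0, w], vector [- w, 0]]"
  have "w * w = - det D" using neg by (simp add: w_def)
  moreover have sym: "D $ 1 $ 2 = D $ 2 $ 1" using D by (simp add: in_sym_matrices_iff)
  ultimately have "det R = 0" by (simp add: R_def det_2 algebra_simps)
  moreover have "sym_part R = D"
    using sym by (simp add: R_def sym_part_def transpose_def vec_eq_iff forall_2)
  ultimately show ?thesis by blast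
qed

lemma symmetric_polyaffine_det_nonpos:
  assumes "symmetric_polyaffine f" "D \<in> sym_matrices" "det D \<le> 0"
  shows "affine_along sym_matrices f D"
  using ex_singular_sym_part[OF assms(2,3)] symmetric_polyaffine_singular_line[OF assms(1)] by blast

lemma symmetric_polyaffine_affine_along:
  assumes f: "symmetric_polyaffine f" and D: "D \<in> sym_matrices"
  shows "affine_along sym_matrices f D"
proof (cases "det D \<le> 0")
  case True
  then show ?thesis using symmetric_polyaffine_det_nonpos f D by blast
next
  case False
  define U :: "real^2^2" where "U = vector [vector [D $ 1 $ 1, 0], vector [0, 0]]"
  define V :: "real^2^2" where
    "V = vector [vector [0, D $ 1 $ 2], vector [D $ 1 $ 2, D $ 2 $ 2]]"
  have sym: "D $ 1 $ 2 = D $ 2 $ 1" using D by (simp add: in_sym_matrices_iff)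
  then have D_eq: "D = U + V" by (simp add: U_def V_def vec_eq_iff forall_2)
  have U: "U \<in> sym_matrices" and V: "V \<in> sym_matrices"
    by (simp_all add: U_def V_def in_sym_matrices_iff)
  have UV: "U - V \<in> sym_matrices" by (rule subspace_diff[OF subspace_sym_matrices U V])
  have "det U \<le> 0" "det V \<le> 0" by (simp_all add: U_def V_def det_2)
  \<comment> \<open>Positivity of \<open>det D\<close> forces its diagonal entries to have a positive product, and these enter
    \<open>U - V\<close> with opposite signs.\<close>
  moreover have "det (U - V) \<le> 0"
  proof -
    have "D $ 1 $ 1 * D $ 2 $ 2 > D $ 1 $ 2 * D $ 1 $ 2"
      using False sym by (simp add: det_2)
    moreover have "D $ 1 $ 2 * D $ 1 $ 2 \<ge> 0" by simp
    moreover have "det (U - V) = - (D $ 1 $ 1 * D $ 2 $ 2) - D $ 1 $ 2 * D $ 1 $ 2"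
      by (simp add: det_2 U_def V_def)
    ultimately show ?thesis by linarith
  qed
  ultimately show ?thesis unfolding D_eq
    using affine_along_sum[OF subspace_sym_matrices U V] symmetric_polyaffine_det_nonpos[OF f]
      U V UV by blast
qed

section \<open>The characterization\<close>

lemma affine_imp_symmetric_polyconvex:
  assumes "affine_function_on sym_matrices f"
  shows "symmetric_polyconvex f"
proof -
  obtain L c where L: "linear_functional_on sym_matrices L"
    and f: "\<And>x. x \<in> sym_matrices \<Longrightarrow> f x = L x + c"
    using assms by (auto simp: affine_function_on_def)
  define G :: "(real^2^2) \<times> real \<Rightarrow> real" where "G = (\<lambda>p. L (sym_part (fst p)) + c)"
  have lin: "linear (\<lambda>F. L (sym_part F))"
    using L by (intro linearI)
      (simp_all add: linear_functional_on_def linear_add[OF linear_sym_part]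
        linear_scale[OF linear_sym_part] sym_part_in_sym_matrices)
  have "G ((1 - t) *\<^sub>R x + t *\<^sub>R y) = (1 - t) * G x + t * G y" for t x y
    unfolding G_def fst_add fst_scaleR linear_add[OF lin] linear_scale[OF lin] real_scaleR_def
    by (simp add: algebra_simps)
  then have "convex_on UNIV G" by (intro convex_onI) simp_all
  moreover have "\<forall>F. f (sym_part F) = G (F, det F)"
    by (simp add: G_def f sym_part_in_sym_matrices)
  ultimately show ?thesis unfolding symmetric_polyconvex_def polyconvex_def by blast
qed

lemma affine_function_on_uminus:
  assumes "affine_function_on S f"
  shows "affine_function_on S (\<lambda>x. - f x)"
proof -
  obtain L c where "linear_functional_on S L" "\<forall>x\<in>S. f x = L x + c"
    using assms by (auto simp: affine_function_on_def)
  then have "linear_functional_on S (\<lambda>x. - L x)" "\<forall>x\<in>S. - f x = - L x + (- c)"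
    by (simp_all add: linear_functional_on_def)
  then show ?thesis unfolding affine_function_on_def by blast
qed

theorem mainTheorem7:
  fixes f :: "real^2^2 \<Rightarrow> real"
  shows "symmetric_polyaffine f \<longleftrightarrow> affine_function_on sym_matrices f"
proof
  assume "symmetric_polyaffine f"
  then show "affine_function_on sym_matrices f"
    by (intro affine_function_on_if_affine_along subspace_sym_matrices
        symmetric_polyaffine_affine_along)
next
  assume "affine_function_on sym_matrices f"
  then show "symmetric_polyaffine f"
    unfolding symmetric_polyaffine_def
    by (intro conjI affine_imp_symmetric_polyconvex affine_function_on_uminus)
qed

end
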